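(* Let $\Phi_L,\Phi_R:\mathbb{R}\to M_3(\mathbb{C})$ and $A:\mathbb{R}\to\mathfrak{su}(3)$ be smooth and form a static one-dimensional soliton solution of the Ginzburg–Landau equations of motion, i.e. they satisfy equations (1)–(3) of the context and approach ground states as $x\to\pm\infty$ (in the sense stated in the context). If $\Phi_L(x)$ and $\Phi_R(x)$ are real-valued diagonal matrices for all $x$, then the gauge field vanishes: $A(x)=0$ for all $x\in\mathbb{R}$.
   Context: $\mathfrak{su}(3)$ denotes the traceless anti-Hermitian $3\times3$ complex matrices; primes denote $d/dx$; $m,\lambda_1,\dots,\lambda_4,\gamma_1,\gamma_2,\gamma_3$ are real constants. Write $D\Phi:=\Phi'-A\Phi$, $D^2\Phi:=D(D\Phi)$, and $\{X,Y\}=XY+YX$. In one spatial dimension the gauge field strength vanishes identically, and the equations of motion are: (1) $-D^2\Phi_L-\frac{m^2}{2}\Phi_L+\frac{\lambda_1}{2}\Phi_L\Phi_L^\dagger\Phi_L+\frac{\lambda_2}{6}\Phi_L\mathrm{Tr}(\Phi_L^\dagger\Phi_L)+\frac{\lambda_3}{6}\Phi_L\mathrm{Tr}(\Phi_R^\dagger\Phi_R)+\frac{\lambda_4}{2}\Phi_R\Phi_R^\dagger\Phi_L+\gamma_1\Phi_R+2\gamma_2\Phi_R\Phi_L^\dagger\Phi_R+\gamma_3\Xi_L=0$; (2) the same equation with $L$ and $R$ interchanged everywhere; (3) the traceless part of the matrix $\{A,\Phi_L\Phi_L^\dagger+\Phi_R\Phi_R^\dagger\}-\Phi_L'\Phi_L^\dagger+\Phi_L(\Phi_L^\dagger)'-\Phi_R'\Phi_R^\dagger+\Phi_R(\Phi_R^\dagger)'$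 vanishes, where the traceless part of $X$ is $X-\frac13\mathrm{Tr}(X)\mathbf{1}_3$. Here $(\Xi_L)_{\alpha a}=\frac12\sum\epsilon_{abc}\epsilon_{def}(\Phi_R)_{\alpha d}(\Phi_L^\dagger\Phi_R)_{be}(\Phi_L^\dagger\Phi_R)_{cf}$ (sum over $b,c,d,e,f\in\{1,2,3\}$, $\epsilon$ the Levi-Civita symbol), and $\Xi_R$ is obtained by interchanging $L$ and $R$. "Approach ground states": the limits of $\Phi_L,\Phi_R$ as $x\to\pm\infty$ exist, and $\lim_{x\to\pm\infty}(\Phi_L\Phi_L^\dagger+\Phi_R\Phi_R^\dagger)=c_\pm\mathbf{1}_3$ with constants $c_\pm>0$ (all ground states considered have this property). *)

theory Defs
  imports "HOL-Analysis.Analysis"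
begin

type_synonym mat3 = "complex ^ 3 ^ 3"

definition dagger :: "mat3 \<Rightarrow> mat3" where
  "dagger M = map_matrix cnj (transpose M)"

definition cscale :: "complex \<Rightarrow> mat3 \<Rightarrow> mat3" where
  "cscale c M = map_matrix ((*) c) M"

definition anticommutator :: "mat3 \<Rightarrow> mat3 \<Rightarrow> mat3" where
  "anticommutator X Y = X ** Y + Y ** X"

definition traceless_part :: "mat3 \<Rightarrow> mat3" where
  "traceless_part X = X - cscale (trace X / 3) (mat 1)"

definition su3 :: "mat3 set" where
  "su3 = {X. dagger X = - X \<and> trace X = 0}"

definition real_diagonal :: "mat3 \<Rightarrow> bool" where
  "real_diagonal M \<longleftrightarrow> (\<forall>i j. M $ i $ j \<in> \<real> \<and> (i \<noteq> j \<longrightarrow> M $ i $ j = 0))"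

definition vderiv :: "(real \<Rightarrow> 'a::real_normed_vector) \<Rightarrow> real \<Rightarrow> 'a" where
  "vderiv f x = vector_derivative f (at x)"

definition smooth :: "(real \<Rightarrow> 'a::real_normed_vector) \<Rightarrow> bool" where
  "smooth f \<longleftrightarrow> (\<forall>n x. (vderiv ^^ n) f differentiable (at x))"

(* The elements of the index type 3 are 1, 2 and 3 (where 3 = 0). *)
definition levi_civita :: "3 \<Rightarrow> 3 \<Rightarrow> 3 \<Rightarrow> complex" where
  "levi_civita i j k =
     (if (i, j, k) \<in> {(1, 2, 3), (2, 3, 1), (3, 1, 2)} then 1
      else if (i, j, k) \<in> {(3, 2, 1), (1, 3, 2), (2, 1, 3)} then - 1
      else 0)"

definition cov_deriv :: "(real \<Rightarrow> mat3) \<Rightarrow> (real \<Rightarrow> mat3) \<Rightarrow> real \<Rightarrow> mat3" where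
  "cov_deriv A \<Phi> x = vderiv \<Phi> x - A x ** \<Phi> x"

(* Xi P Q is the matrix Xi_L for P = Phi_L and Q = Phi_R, and Xi Q P is Xi_R. *)
definition Xi :: "mat3 \<Rightarrow> mat3 \<Rightarrow> mat3" where
  "Xi P Q = (\<chi> \<alpha> a. 1 / 2 *
     (\<Sum>b\<in>UNIV. \<Sum>c\<in>UNIV. \<Sum>d\<in>UNIV. \<Sum>e\<in>UNIV. \<Sum>f\<in>UNIV.
        levi_civita a b c * levi_civita d e f * Q $ \<alpha> $ d
        * (dagger P ** Q) $ b $ e * (dagger P ** Q) $ c $ f))"

(* Left-hand side of the scalar field equation for P; the equation for Q is obtained by
   exchanging the last two function arguments. *)
definition scalar_eom ::
  "real \<Rightarrow> real \<Rightarrow> real \<Rightarrow> real \<Rightarrow> real \<Rightarrow> real \<Rightarrow> real \<Rightarrow> real \<Rightarrow>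
   (real \<Rightarrow> mat3) \<Rightarrow> (real \<Rightarrow> mat3) \<Rightarrow> (real \<Rightarrow> mat3) \<Rightarrow> real \<Rightarrow> mat3" where
  "scalar_eom m l1 l2 l3 l4 g1 g2 g3 A P Q x =
     - cov_deriv A (cov_deriv A P) x
     - (m\<^sup>2 / 2) *\<^sub>R P x
     + (l1 / 2) *\<^sub>R (P x ** dagger (P x) ** P x)
     + (l2 / 6) *\<^sub>R cscale (trace (dagger (P x) ** P x)) (P x)
     + (l3 / 6) *\<^sub>R cscale (trace (dagger (Q x) ** Q x)) (P x)
     + (l4 / 2) *\<^sub>R (Q x ** dagger (Q x) ** P x)
     + g1 *\<^sub>R Q x
     + (2 * g2) *\<^sub>R (Q x ** dagger (P x) ** Q x)
     + g3 *\<^sub>R Xi (P x) (Q x)"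

definition gauge_eom ::
  "(real \<Rightarrow> mat3) \<Rightarrow> (real \<Rightarrow> mat3) \<Rightarrow> (real \<Rightarrow> mat3) \<Rightarrow> real \<Rightarrow> mat3" where
  "gauge_eom A P Q x = traceless_part
     (anticommutator (A x) (P x ** dagger (P x) + Q x ** dagger (Q x))
      - vderiv P x ** dagger (P x) + P x ** vderiv (\<lambda>y. dagger (P y)) x
      - vderiv Q x ** dagger (Q x) + Q x ** vderiv (\<lambda>y. dagger (Q y)) x)"

definition approaches_ground_state ::
  "(real \<Rightarrow> mat3) \<Rightarrow> (real \<Rightarrow> mat3) \<Rightarrow> real filter \<Rightarrow> bool" where
  "approaches_ground_state P Q F \<longleftrightarrow>
     (\<exists>L. (P \<longlongrightarrow> L) F) \<and> (\<exists>R. (Q \<longlongrightarrow> R) F) \<and>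
     (\<exists>c::real. c > 0 \<and>
        ((\<lambda>x. P x ** dagger (P x) + Q x ** dagger (Q x)) \<longlongrightarrow> c *\<^sub>R mat 1) F)"

definition gl_soliton ::
  "real \<Rightarrow> real \<Rightarrow> real \<Rightarrow> real \<Rightarrow> real \<Rightarrow> real \<Rightarrow> real \<Rightarrow> real \<Rightarrow>
   (real \<Rightarrow> mat3) \<Rightarrow> (real \<Rightarrow> mat3) \<Rightarrow> (real \<Rightarrow> mat3) \<Rightarrow> bool" where
  "gl_soliton m l1 l2 l3 l4 g1 g2 g3 A \<Phi>\<^sub>L \<Phi>\<^sub>R \<longleftrightarrow>
     (\<forall>x. scalar_eom m l1 l2 l3 l4 g1 g2 g3 A \<Phi>\<^sub>L \<Phi>\<^sub>R x = 0) \<and>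
     (\<forall>x. scalar_eom m l1 l2 l3 l4 g1 g2 g3 A \<Phi>\<^sub>R \<Phi>\<^sub>L x = 0) \<and>
     (\<forall>x. gauge_eom A \<Phi>\<^sub>L \<Phi>\<^sub>R x = 0) \<and>
     approaches_ground_state \<Phi>\<^sub>L \<Phi>\<^sub>R at_top \<and>
     approaches_ground_state \<Phi>\<^sub>L \<Phi>\<^sub>R at_bot"

end

theory Submission
  imports Defs
begin

text \<open>
  For diagonal real fields the gauge equation reads \<open>{A, M} \<propto> 1\<close> with
  \<open>M = \<Phi>\<^sub>L\<^sup>2 + \<Phi>\<^sub>R\<^sup>2\<close> diagonal, and it forces \<open>A = 0\<close> at every point where all
  diagonal entries of \<open>M\<close> are positive. The \<open>i\<close>-th diagonal entries of \<open>\<Phi>\<^sub>L\<close> and \<open>\<Phi>\<^sub>R\<close>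
  together solve a homogeneous linear second-order system with continuous coefficients, so if
  both vanished on an interval they would vanish everywhere, contradicting the positive limit of
  \<open>M\<close>. Hence \<open>A\<close> vanishes on a dense set, and by continuity everywhere.
\<close>

section \<open>Gronwall-type uniqueness for linear differential inequalities\<close>

text \<open>Gronwall's argument in energy form: the derivative of \<open>f x \<bullet> f x\<close>
  is at most \<open>2 * K\<close> times itself, so the weight \<open>exp (- 2 * K * x)\<close> makes
  the squared norm nonincreasing. It starts at zero and is nonnegative, hence stays zero.\<close>

lemma vanishing_forward:
  fixes f :: "real \<Rightarrow> 'a::real_inner"
  assumes deriv: "\<And>x. (f has_vector_derivative f' x) (at x)"
    and bound: "\<And>x. x \<in> {a..b} \<Longrightarrow> norm (f' x) \<le> K * norm (f x)"
    and "f a = 0" "a \<le> b"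
  shows "f b = 0"
proof -
  define h where "h x = exp (- 2 * K * x) * (f x \<bullet> f x)" for x
  have "h b \<le> h a"
  proof (rule DERIV_nonpos_imp_nonincreasing[OF \<open>a \<le> b\<close>])
    fix x assume x: "a \<le> x" "x \<le> b"
    have "((\<lambda>x. f x \<bullet> f x) has_vector_derivative (f x \<bullet> f' x + f' x \<bullet> f x)) (at x)"
      by (rule bounded_bilinear.has_vector_derivative[OF bounded_bilinear_inner deriv deriv])
    then have "((\<lambda>x. f x \<bullet> f x) has_real_derivative 2 * (f x \<bullet> f' x)) (at x)"
      by (simp add: has_real_derivative_iff_has_vector_derivative inner_commute)
    then have "(h has_real_derivative
        exp (- 2 * K * x) * (2 * (f x \<bullet> f' x) - 2 * K * (f x \<bullet> f x))) (at x)"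
      unfolding h_def by (auto intro!: derivative_eq_intros simp: algebra_simps)
    moreover have "f x \<bullet> f' x \<le> K * (f x \<bullet> f x)"
    proof -
      have "f x \<bullet> f' x \<le> norm (f x) * norm (f' x)"
        by (rule norm_cauchy_schwarz)
      also have "\<dots> \<le> norm (f x) * (K * norm (f x))"
        using bound[of x] x by (intro mult_left_mono) auto
      also have "\<dots> = K * (f x \<bullet> f x)"
        by (simp add: dot_square_norm power2_eq_square)
      finally show ?thesis .
    qed
    ultimately show "\<exists>y. (h has_real_derivative y) (at x) \<and> y \<le> 0"
      by (intro exI conjI) (auto simp: mult_le_0_iff)
  qed
  then have "f b \<bullet> f b \<le> 0"
    using \<open>f a = 0\<close> by (simp add: h_def mult_le_0_iff)
  then show ?thesis
    by (metis inner_ge_zero inner_eq_zero_iff order_antisym)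
qed

text \<open>A zero spreads in both directions. \<open>K\<close> may depend on the interval, since
  the coefficients met later are bounded only on compact sets.\<close>

lemma vanishing_everywhere:
  fixes f :: "real \<Rightarrow> 'a::real_inner"
  assumes deriv: "\<And>x. (f has_vector_derivative f' x) (at x)"
    and bound: "\<And>a b. \<exists>K. \<forall>x\<in>{a..b}. norm (f' x) \<le> K * norm (f x)"
    and "f a = 0"
  shows "f b = 0"
proof (cases "a \<le> b")
  case True
  then show ?thesis
    using vanishing_forward[OF deriv] bound \<open>f a = 0\<close> by metis
next
  case False
  obtain K where K: "\<forall>x\<in>{b..a}. norm (f' x) \<le> K * norm (f x)"
    using bound by blast
  \<comment> \<open>For \<open>b < a\<close> the forward result is applied to the reflected
    function, which runs from \<open>- a\<close> to \<open>- b\<close>.\<close>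
  have "((\<lambda>x. f (- x)) has_vector_derivative - f' (- x)) (at x)" for x
  proof -
    have "(uminus has_vector_derivative - 1) (at x)"
      using has_vector_derivative_minus[OF has_vector_derivative_id] by simp
    from vector_diff_chain_at[OF this deriv] show ?thesis
      by (simp add: o_def)
  qed
  then have "f (- (- b)) = 0"
    using K False \<open>f a = 0\<close>
    by (intro vanishing_forward[of "\<lambda>x. f (- x)" "\<lambda>x. - f' (- x)" "- a" "- b" K]) auto
  then show ?thesis
    by simp
qed

lemma continuous_on_bounded_Icc:
  fixes f :: "real \<Rightarrow> 'a::real_normed_vector"
  assumes "continuous_on UNIV f"
  obtains K where "K \<ge> 0" "\<And>x. x \<in> {a..b} \<Longrightarrow> norm (f x) \<le> K"
proof -
  have "bounded (f ` {a..b})"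
    using assms by (intro compact_imp_bounded compact_continuous_image)
      (auto intro: continuous_on_subset)
  then obtain K where "\<forall>y\<in>f ` {a..b}. norm y \<le> K"
    unfolding bounded_iff by blast
  then show ?thesis
    by (intro that[of "max 0 K"]) (auto simp: le_max_iff_disj)
qed

text \<open>Unique continuation for two coupled linear equations: the vector of \<open>p\<close>,
  \<open>q\<close> and their derivatives solves a first-order system with locally bounded
  coefficients, so zero initial data force the zero solution.\<close>

lemma second_order_system_vanishing:
  fixes p q :: "real \<Rightarrow> complex"
  assumes dp: "\<And>x. (p has_vector_derivative p' x) (at x)"
    and dp': "\<And>x. (p' has_vector_derivative a1 x * p x + a2 x * p' x + a3 x * q x) (at x)"
    and dq: "\<And>x. (q has_vector_derivative q' x) (at x)"
    and dq': "\<And>x. (q' has_vector_derivative b1 x * q x + b2 x * q' x + b3 x * p x) (at x)"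
    and cont: "continuous_on UNIV a1" "continuous_on UNIV a2" "continuous_on UNIV a3"
      "continuous_on UNIV b1" "continuous_on UNIV b2" "continuous_on UNIV b3"
    and init: "p x0 = 0" "p' x0 = 0" "q x0 = 0" "q' x0 = 0"
  shows "p x = 0 \<and> q x = 0"
proof -
  define f where "f x = (p x, q x, p' x, q' x)" for x
  define f' where "f' x = (p' x, q' x, a1 x * p x + a2 x * p' x + a3 x * q x,
    b1 x * q x + b2 x * q' x + b3 x * p x)" for x
  have "(f has_vector_derivative f' x) (at x)" for x
    unfolding f_def f'_def
    by (intro has_vector_derivative_Pair dp dq dp' dq')
  moreover have "\<exists>K. \<forall>x\<in>{a..b}. norm (f' x) \<le> K * norm (f x)" for a b
  proof -
    obtain A1 where a1: "\<And>x. x \<in> {a..b} \<Longrightarrow> norm (a1 x) \<le> A1"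
      using continuous_on_bounded_Icc[OF cont(1)] by blast
    obtain A2 where a2: "\<And>x. x \<in> {a..b} \<Longrightarrow> norm (a2 x) \<le> A2"
      using continuous_on_bounded_Icc[OF cont(2)] by blast
    obtain A3 where a3: "\<And>x. x \<in> {a..b} \<Longrightarrow> norm (a3 x) \<le> A3"
      using continuous_on_bounded_Icc[OF cont(3)] by blast
    obtain B1 where b1: "\<And>x. x \<in> {a..b} \<Longrightarrow> norm (b1 x) \<le> B1"
      using continuous_on_bounded_Icc[OF cont(4)] by blast
    obtain B2 where b2: "\<And>x. x \<in> {a..b} \<Longrightarrow> norm (b2 x) \<le> B2"
      using continuous_on_bounded_Icc[OF cont(5)] by blast
    obtain B3 where b3: "\<And>x. x \<in> {a..b} \<Longrightarrow> norm (b3 x) \<le> B3"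
      using continuous_on_bounded_Icc[OF cont(6)] by blast
    \<comment> \<open>The summand 2 pays for the components \<open>p'\<close> and \<open>q'\<close>
      of \<open>f'\<close>, which are themselves components of \<open>f\<close>; each bound on a
      coefficient pays for one product.\<close>
    have "norm (f' x) \<le> (2 + A1 + A2 + A3 + B1 + B2 + B3) * norm (f x)" if "x \<in> {a..b}" for x
    proof -
      let ?n = "norm (f x)"
      have p: "norm (p x) \<le> ?n"
        unfolding f_def by (rule norm_fst_le)
      have q: "norm (q x) \<le> ?n"
          unfolding f_def by (rule order_trans[OF norm_fst_le norm_snd_le])
      have p': "norm (p' x) \<le> ?n"
        unfolding f_def by (rule order_trans[OF order_trans[OF norm_fst_le norm_snd_le] norm_snd_le])
      have q': "norm (q' x) \<le> ?n"
        unfolding f_def by (rule order_trans[OF order_trans[OF norm_snd_le norm_snd_le] norm_snd_le])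
      have mult: "norm (c * z) \<le> C * ?n" if "norm c \<le> C" "norm z \<le> ?n" for c z :: complex and C
        unfolding norm_mult using that norm_ge_zero[of c]
        by (intro mult_mono) (linarith+ | simp)+
      have "norm (a1 x * p x + a2 x * p' x + a3 x * q x) \<le> A1 * ?n + A2 * ?n + A3 * ?n"
        using that by (intro norm_triangle_le add_mono mult p p' q a1 a2 a3)
      moreover have "norm (b1 x * q x + b2 x * q' x + b3 x * p x) \<le> B1 * ?n + B2 * ?n + B3 * ?n"
        using that by (intro norm_triangle_le add_mono mult q q' p b1 b2 b3)
      moreover have "norm (f' x) \<le> norm (p' x) + (norm (q' x) +
        (norm (a1 x * p x + a2 x * p' x + a3 x * q x)
          + norm (b1 x * q x + b2 x * q' x + b3 x * p x)))"
        unfolding f'_def by (intro order_trans[OF norm_Pair_le] add_left_mono order_refl)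
      ultimately show ?thesis
        using p' q' by (simp add: algebra_simps)
    qed
    then show ?thesis
      by blast
  qed
  moreover have "f x0 = 0"
    using init by (simp add: f_def zero_prod_def)
  ultimately have "f x = 0"
    by (rule vanishing_everywhere)
  then show ?thesis
    by (simp add: f_def zero_prod_def)
qed

section \<open>Calculus of smooth matrix-valued functions\<close>

lemma smooth_has_vector_derivative:
  assumes "smooth f"
  shows "(f has_vector_derivative vderiv f x) (at x)"
proof -
  have "f differentiable (at x)"
    using assms unfolding smooth_def by (metis funpow_0)
  then show ?thesis
    by (simp add: vderiv_def vector_derivative_works)
qed

lemma smooth_vderiv:
  assumes "smooth f"
  shows "smooth (vderiv f)"
  using assms unfolding smooth_def by (metis comp_apply funpow_Suc_right)

lemma smooth_continuous_on:
  assumes "smooth f"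
  shows "continuous_on UNIV f"
  using smooth_has_vector_derivative[OF assms]
  by (auto simp: continuous_on_eq_continuous_at intro: has_vector_derivative_continuous)

lemma vderiv_eqI: "(f has_vector_derivative D) (at x) \<Longrightarrow> vderiv f x = D"
  by (simp add: vderiv_def vector_derivative_at)

lemma has_vector_derivative_entry:
  fixes F :: "real \<Rightarrow> mat3"
  assumes "(F has_vector_derivative D) (at x)"
  shows "((\<lambda>x. F x $ i $ j) has_vector_derivative D $ i $ j) (at x)"
proof -
  have "bounded_linear (\<lambda>M :: mat3. M $ i $ j)"
    by (intro bounded_linear_compose[OF bounded_linear_vec_nth bounded_linear_vec_nth])
  from bounded_linear.has_vector_derivative[OF this assms] show ?thesis .
qed

text \<open>Matrix multiplication is bilinear between finite-dimensional spaces, hence bounded, and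
  the general product rule applies.\<close>

lemma has_vector_derivative_matrix_mult:
  fixes F G :: "real \<Rightarrow> mat3"
  assumes "(F has_vector_derivative F') (at x)" "(G has_vector_derivative G') (at x)"
  shows "((\<lambda>x. F x ** G x) has_vector_derivative (F x ** G' + F' ** G x)) (at x)"
proof -
  have "bilinear (\<lambda>(M :: mat3) (N :: mat3). M ** N)"
    by (auto simp: bilinear_def matrix_matrix_mult_def vec_eq_iff algebra_simps sum.distrib
        scaleR_sum_right intro!: linearI)
  then have "bounded_bilinear (\<lambda>(M :: mat3) (N :: mat3). M ** N)"
    by (simp add: bilinear_conv_bounded_bilinear)
  from bounded_bilinear.has_vector_derivative[OF this assms] show ?thesis .
qed

lemma matrix_diff_ldistrib: "M ** (N - K) = M ** N - M ** K" for M N K :: mat3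
  by (simp add: vec_eq_iff matrix_matrix_mult_def right_diff_distrib sum_subtractf)

text \<open>Isolates the second derivative of \<open>P\<close>, so that the scalar equation can be
  solved for it.\<close>

lemma cov_deriv_twice:
  assumes "smooth A" "smooth P"
  shows "cov_deriv A (cov_deriv A P) x = vderiv (vderiv P) x - vderiv A x ** P x
    - 2 *\<^sub>R (A x ** vderiv P x) + A x ** A x ** P x"
proof -
  have "((\<lambda>x. vderiv P x - A x ** P x) has_vector_derivative
      vderiv (vderiv P) x - (A x ** vderiv P x + vderiv A x ** P x)) (at x)"
    by (intro has_vector_derivative_diff has_vector_derivative_matrix_mult
        smooth_has_vector_derivative smooth_vderiv assms)
  then have "vderiv (cov_deriv A P) x
      = vderiv (vderiv P) x - (A x ** vderiv P x + vderiv A x ** P x)"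
    unfolding cov_deriv_def[abs_def] by (rule vderiv_eqI)
  then show ?thesis
    unfolding cov_deriv_def[of A "cov_deriv A P"]
    by (simp add: cov_deriv_def matrix_diff_ldistrib matrix_mul_assoc algebra_simps scaleR_2)
qed

section \<open>Real diagonal matrices and the term \<open>Xi\<close>\<close>

lemma matrix_mult_diagonal_right:
  fixes M N :: mat3
  assumes "\<And>i j. i \<noteq> j \<Longrightarrow> N $ i $ j = 0"
  shows "(M ** N) $ i $ j = M $ i $ j * N $ j $ j"
proof -
  have "(M ** N) $ i $ j = (\<Sum>k\<in>UNIV. if k = j then M $ i $ k * N $ k $ j else 0)"
    unfolding matrix_matrix_mult_def vec_lambda_beta by (intro sum.cong) (auto simp: assms)
  then show ?thesis
    by simp
qed

lemma matrix_mult_diagonal_left: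
  fixes M N :: mat3
  assumes "\<And>i j. i \<noteq> j \<Longrightarrow> M $ i $ j = 0"
  shows "(M ** N) $ i $ j = M $ i $ i * N $ i $ j"
proof -
  have "(M ** N) $ i $ j = (\<Sum>k\<in>UNIV. if k = i then M $ i $ k * N $ k $ j else 0)"
    unfolding matrix_matrix_mult_def vec_lambda_beta by (intro sum.cong) (auto simp: assms)
  then show ?thesis
    by simp
qed

lemma real_diagonal_offdiag: "real_diagonal M \<Longrightarrow> i \<noteq> j \<Longrightarrow> M $ i $ j = 0"
  by (simp add: real_diagonal_def)

lemma dagger_real_diagonal: "real_diagonal M \<Longrightarrow> dagger M = M"
  unfolding dagger_def vec_eq_iff nth_map_matrix transpose_def vec_lambda_beta real_diagonal_def
  by (metis Reals_cnj_iff)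

text \<open>Differentiation preserves diagonality, so the diagonal entries of
  \<open>A x ** vderiv P x\<close> involve only the diagonal of \<open>A x\<close>.\<close>

lemma vderiv_offdiag:
  assumes "smooth P" "\<And>x. real_diagonal (P x)" "i \<noteq> j"
  shows "vderiv P x $ i $ j = 0"
proof -
  have "((\<lambda>x. P x $ i $ j) has_vector_derivative vderiv P x $ i $ j) (at x)"
    by (intro has_vector_derivative_entry smooth_has_vector_derivative assms)
  moreover have "(\<lambda>x. P x $ i $ j) = (\<lambda>x. 0)"
    using assms by (auto simp: real_diagonal_def)
  ultimately show ?thesis
    by (auto dest: vector_derivative_unique_at[OF has_vector_derivative_const])
qed

text \<open>This is the cofactor of \<open>P ** Q\<close> at position \<open>(i, i)\<close>, kept as
  a Levi-Civita sum so that it matches \<open>Xi\<close> term by term.\<close>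

definition Xi_coeff :: "mat3 \<Rightarrow> mat3 \<Rightarrow> 3 \<Rightarrow> complex" where
  "Xi_coeff P Q i = 1 / 2 *
     (\<Sum>b\<in>UNIV. \<Sum>c\<in>UNIV. \<Sum>e\<in>UNIV. \<Sum>f\<in>UNIV.
        levi_civita i b c * levi_civita i e f * (P ** Q) $ b $ e * (P ** Q) $ c $ f)"

text \<open>Since \<open>Q\<close> is diagonal, only \<open>d = i\<close> survives in the sum over
  \<open>d\<close>. The factor \<open>Q $ i $ i\<close> thus exposed is what makes this term fit a
  homogeneous linear equation.\<close>

lemma Xi_diagonal_entry:
  assumes "real_diagonal P" "real_diagonal Q"
  shows "Xi P Q $ i $ i = Xi_coeff P Q i * Q $ i $ i"
proof -
  have "(\<Sum>d\<in>UNIV. \<Sum>e\<in>UNIV. \<Sum>f\<in>UNIV. levi_civita i b c * levi_civita d e f * Q $ i $ d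
        * (P ** Q) $ b $ e * (P ** Q) $ c $ f)
      = (\<Sum>e\<in>UNIV. \<Sum>f\<in>UNIV. levi_civita i b c * levi_civita i e f
        * (P ** Q) $ b $ e * (P ** Q) $ c $ f) * Q $ i $ i" (is "?l = ?r") for b c
  proof -
    have "?l = (\<Sum>d\<in>UNIV. if d = i then \<Sum>e\<in>UNIV. \<Sum>f\<in>UNIV. levi_civita i b c
      * levi_civita d e f * Q $ i $ d * (P ** Q) $ b $ e * (P ** Q) $ c $ f else 0)"
      using real_diagonal_offdiag[OF assms(2)] by (intro sum.cong) auto
    then show ?thesis
      by (simp add: sum_distrib_left sum_distrib_right mult_ac)
  qed
  then show ?thesis
    unfolding Xi_def Xi_coeff_def dagger_real_diagonal[OF assms(1)]
    by (simp add: sum_distrib_right)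
qed

lemma continuous_on_matrix_mult_entry:
  fixes F G :: "real \<Rightarrow> mat3"
  assumes "continuous_on S F" "continuous_on S G"
  shows "continuous_on S (\<lambda>x. (F x ** G x) $ i $ j)"
  unfolding matrix_matrix_mult_def by (simp, intro continuous_intros assms)

lemma scaleR_matrix_entry: "(r *\<^sub>R M) $ i $ j = of_real r * M $ i $ j" for M :: mat3
  unfolding vector_scaleR_component by (rule scaleR_conv_of_real)

section \<open>The equations of motion for real diagonal fields\<close>

text \<open>In the \<open>(i, i)\<close> entry every term other than the second derivative carries a
  factor \<open>P $ i $ i\<close>, its first derivative or \<open>Q $ i $ i\<close>. The remaining
  factors, even those built from the fields, are regarded as known continuous coefficients along the
  given solution, which turns the nonlinear equation into a linear one.\<close>

lemma scalar_eom_linear_form: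
  assumes smooth: "smooth A" "smooth P" "smooth Q"
    and diag: "\<And>x. real_diagonal (P x)" "\<And>x. real_diagonal (Q x)"
    and eom: "\<And>x. scalar_eom m l1 l2 l3 l4 g1 g2 g3 A P Q x = 0"
  obtains a b c :: "real \<Rightarrow> complex"
  where "continuous_on UNIV a" "continuous_on UNIV b" "continuous_on UNIV c"
    "\<And>x. vderiv (vderiv P) x $ i $ i
        = a x * P x $ i $ i + b x * vderiv P x $ i $ i + c x * Q x $ i $ i"
proof
  let ?a = "\<lambda>x. vderiv A x $ i $ i - (A x ** A x) $ i $ i - of_real (m\<^sup>2 / 2)
    + of_real (l1 / 2) * (P x $ i $ i * P x $ i $ i) + of_real (l2 / 6) * trace (P x ** P x)
    + of_real (l3 / 6) * trace (Q x ** Q x) + of_real (l4 / 2) * (Q x $ i $ i * Q x $ i $ i)"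
  let ?b = "\<lambda>x. 2 * A x $ i $ i"
  let ?c = "\<lambda>x. of_real g1 + of_real (2 * g2) * (Q x $ i $ i * P x $ i $ i)
    + of_real g3 * Xi_coeff (P x) (Q x) i"
  note cont = smooth[THEN smooth_continuous_on] smooth_vderiv[THEN smooth_continuous_on]
  show "continuous_on UNIV ?a"
    unfolding trace_def
    by (intro continuous_intros continuous_on_matrix_mult_entry cont smooth)
  show "continuous_on UNIV ?b"
    by (intro continuous_intros cont)
  show "continuous_on UNIV ?c"
    unfolding Xi_coeff_def
    by (intro continuous_intros continuous_on_matrix_mult_entry cont)
  show "vderiv (vderiv P) x $ i $ i
      = ?a x * P x $ i $ i + ?b x * vderiv P x $ i $ i + ?c x * Q x $ i $ i" for x
  proof -
    note P = real_diagonal_offdiag[OF diag(1)[of x]]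
    note Q = real_diagonal_offdiag[OF diag(2)[of x]]
    note P' = vderiv_offdiag[OF smooth(2) diag(1)]
    \<comment> \<open>The second covariant derivative enters the equation with a minus sign, so the
      proposed right-hand side minus the second derivative is exactly this entry of the
      equation.\<close>
    have "?a x * P x $ i $ i + ?b x * vderiv P x $ i $ i + ?c x * Q x $ i $ i
        - vderiv (vderiv P) x $ i $ i = scalar_eom m l1 l2 l3 l4 g1 g2 g3 A P Q x $ i $ i"
      unfolding scalar_eom_def cov_deriv_twice[OF smooth(1,2)]
      by (simp add: dagger_real_diagonal diag matrix_mult_diagonal_right[OF P]
          matrix_mult_diagonal_right[OF Q] matrix_mult_diagonal_right[OF P']
          Xi_diagonal_entry cscale_def scaleR_matrix_entry algebra_simps
          del: vector_scaleR_component)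
    then show ?thesis
      by (simp add: eom)
  qed
qed

text \<open>Each field equals its own adjoint and commutes with its derivative, both being diagonal,
  so the derivative terms cancel in pairs.\<close>

lemma gauge_eom_real_diagonal:
  assumes smooth: "smooth P" "smooth Q"
    and diag: "\<And>x. real_diagonal (P x)" "\<And>x. real_diagonal (Q x)"
  shows "gauge_eom A P Q x = traceless_part (anticommutator (A x) (P x ** P x + Q x ** Q x))"
proof -
  have "vderiv F x ** F x = F x ** vderiv F x" if "smooth F" "\<And>x. real_diagonal (F x)" for F
  proof -
    have "vderiv F x $ i $ j * F x $ j $ j = F x $ i $ i * vderiv F x $ i $ j" for i j
      using vderiv_offdiag[OF that, of i j] by (cases "i = j") auto
    then show ?thesis
      using real_diagonal_offdiag[OF that(2)]
      by (simp add: vec_eq_iff matrix_mult_diagonal_right matrix_mult_diagonal_left)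
  qed
  from this[OF smooth(1) diag(1)] this[OF smooth(2) diag(2)] show ?thesis
    unfolding gauge_eom_def by (simp add: dagger_real_diagonal diag)
qed

text \<open>For diagonal \<open>M\<close> the anticommutator multiplies \<open>A $ i $ j\<close> by
  \<open>\<mu> i + \<mu> j > 0\<close>. Being a multiple of the identity, it kills the off-diagonal
  entries of \<open>A\<close> and gives all diagonal entries the sign pattern of one scalar; the
  zero trace then excludes a nonzero scalar.\<close>

lemma anticommutator_traceless_part_zero:
  fixes A M :: mat3 and \<mu> :: "3 \<Rightarrow> real"
  assumes "trace A = 0" "traceless_part (anticommutator A M) = 0"
    and pos: "\<And>i. \<mu> i > 0"
    and M: "\<And>i. M $ i $ i = of_real (\<mu> i)" "\<And>i j. i \<noteq> j \<Longrightarrow> M $ i $ j = 0"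
  shows "A = 0"
proof -
  define s where "s = trace (anticommutator A M) / 3"
  have eq: "A $ i $ j * of_real (\<mu> i + \<mu> j) = (if i = j then s else 0)" for i j
  proof -
    have "traceless_part (anticommutator A M) $ i $ j = 0"
      using assms(2) by simp
    then show ?thesis
      unfolding traceless_part_def s_def[symmetric]
      by (simp add: cscale_def mat_def anticommutator_def matrix_mult_diagonal_right M
          matrix_mult_diagonal_left algebra_simps split: if_splits)
  qed
  have nz: "complex_of_real (\<mu> i + \<mu> j) \<noteq> 0" for i j
    using pos[of i] pos[of j] by (simp only: of_real_eq_0_iff)
  have "A $ i $ i = s * of_real (1 / (2 * \<mu> i))" for i
    using eq[of i i] nz[of i i] pos[of i] by (simp add: field_simps)
  \<comment> \<open>The left side is the trace of \<open>A\<close>, with \<open>s\<close> factored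
    out.\<close>
  then have "s * of_real (\<Sum>i\<in>UNIV. 1 / (2 * \<mu> i)) = 0"
    using assms(1) by (simp add: trace_def sum_distrib_left)
  moreover have "(\<Sum>i\<in>UNIV. 1 / (2 * \<mu> i)) > 0"
    using pos by (intro sum_pos) auto
  ultimately have "s = 0"
    by (simp only: mult_eq_0_iff of_real_eq_0_iff less_irrefl) auto
  then show ?thesis
    using eq nz by (auto simp: vec_eq_iff split: if_splits)
qed

section \<open>Density of the points with positive diagonal entries, and the conclusion\<close>

theorem lemma2:
  fixes m l1 l2 l3 l4 g1 g2 g3 :: real
    and A \<Phi>\<^sub>L \<Phi>\<^sub>R :: "real \<Rightarrow> mat3"
  assumes "smooth \<Phi>\<^sub>L" and "smooth \<Phi>\<^sub>R" and "smooth A"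
    and "\<And>x. A x \<in> su3"
    and "gl_soliton m l1 l2 l3 l4 g1 g2 g3 A \<Phi>\<^sub>L \<Phi>\<^sub>R"
    and "\<And>x. real_diagonal (\<Phi>\<^sub>L x)" and "\<And>x. real_diagonal (\<Phi>\<^sub>R x)"
  shows "\<forall>x. A x = 0"
proof -
  define Z where "Z i = {x. \<Phi>\<^sub>L x $ i $ i = 0 \<and> \<Phi>\<^sub>R x $ i $ i = 0}" for i
  note deriv = smooth_has_vector_derivative[THEN has_vector_derivative_entry]
  have eomL: "\<And>x. scalar_eom m l1 l2 l3 l4 g1 g2 g3 A \<Phi>\<^sub>L \<Phi>\<^sub>R x = 0"
    and eomR: "\<And>x. scalar_eom m l1 l2 l3 l4 g1 g2 g3 A \<Phi>\<^sub>R \<Phi>\<^sub>L x = 0"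
    and gauge: "\<And>x. gauge_eom A \<Phi>\<^sub>L \<Phi>\<^sub>R x = 0"
    and ground: "approaches_ground_state \<Phi>\<^sub>L \<Phi>\<^sub>R at_top"
    using assms(5) unfolding gl_soliton_def by auto
  have entry: "(\<Phi>\<^sub>L x ** \<Phi>\<^sub>L x + \<Phi>\<^sub>R x ** \<Phi>\<^sub>R x) $ i $ j
      = \<Phi>\<^sub>L x $ i $ j * \<Phi>\<^sub>L x $ j $ j + \<Phi>\<^sub>R x $ i $ j * \<Phi>\<^sub>R x $ j $ j" for x i j
    by (simp add: matrix_mult_diagonal_right real_diagonal_offdiag assms(6,7))
  have Z_interior: "interior (Z i) = {}" for i
  proof (rule ccontr)
    assume "interior (Z i) \<noteq> {}"
    then obtain x0 where x0: "x0 \<in> interior (Z i)"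
      by blast
    \<comment> \<open>Near an interior point of \<open>Z i\<close> the entry is constantly zero, so
      its derivative at \<open>x0\<close> vanishes too; this supplies the full initial data of the
      second-order system.\<close>
    have zero_deriv: "vderiv F x0 $ i $ i = 0"
      if "smooth F" "\<And>x. x \<in> Z i \<Longrightarrow> F x $ i $ i = 0" for F :: "real \<Rightarrow> mat3"
    proof -
      have "((\<lambda>x. 0) has_vector_derivative vderiv F x0 $ i $ i) (at x0)"
        using that interior_subset
        by (intro has_vector_derivative_transform_within_open[OF deriv[OF that(1)]
              open_interior x0]) auto
      then show ?thesis
        by (auto dest: vector_derivative_unique_at[OF has_vector_derivative_const])
    qed
    obtain a1 a2 a3 where a: "continuous_on UNIV a1" "continuous_on UNIV a2" "continuous_on UNIV a3"
      "\<And>x. vderiv (vderiv \<Phi>\<^sub>L) x $ i $ i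
        = a1 x * \<Phi>\<^sub>L x $ i $ i + a2 x * vderiv \<Phi>\<^sub>L x $ i $ i + a3 x * \<Phi>\<^sub>R x $ i $ i"
      using scalar_eom_linear_form[OF assms(3,1,2,6,7) eomL] by blast
    obtain b1 b2 b3 where b: "continuous_on UNIV b1" "continuous_on UNIV b2" "continuous_on UNIV b3"
      "\<And>x. vderiv (vderiv \<Phi>\<^sub>R) x $ i $ i
        = b1 x * \<Phi>\<^sub>R x $ i $ i + b2 x * vderiv \<Phi>\<^sub>R x $ i $ i + b3 x * \<Phi>\<^sub>L x $ i $ i"
      using scalar_eom_linear_form[OF assms(3,2,1,7,6) eomR] by blast
    have vanish: "\<Phi>\<^sub>L x $ i $ i = 0 \<and> \<Phi>\<^sub>R x $ i $ i = 0" for x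
    proof (rule second_order_system_vanishing[of _ "\<lambda>x. vderiv \<Phi>\<^sub>L x $ i $ i" a1 a2 a3
          _ "\<lambda>x. vderiv \<Phi>\<^sub>R x $ i $ i" b1 b2 b3 x0])
      show "\<Phi>\<^sub>L x0 $ i $ i = 0" "\<Phi>\<^sub>R x0 $ i $ i = 0"
        using x0 interior_subset by (auto simp: Z_def)
      show "vderiv \<Phi>\<^sub>L x0 $ i $ i = 0" "vderiv \<Phi>\<^sub>R x0 $ i $ i = 0"
        using assms(1,2) by (auto intro!: zero_deriv simp: Z_def)
    qed (use a(1-3) b(1-3) deriv assms(1,2) in \<open>auto simp flip: a(4) b(4) intro: deriv smooth_vderiv\<close>)
    obtain c :: real where "c > 0" and c: "((\<lambda>x. \<Phi>\<^sub>L x ** dagger (\<Phi>\<^sub>L x)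
        + \<Phi>\<^sub>R x ** dagger (\<Phi>\<^sub>R x)) \<longlongrightarrow> c *\<^sub>R mat 1) at_top"
      using ground unfolding approaches_ground_state_def by blast
    \<comment> \<open>This entry is now identically zero, yet the ground state condition makes it
      tend to \<open>c > 0\<close>.\<close>
    have "((\<lambda>x. (\<Phi>\<^sub>L x ** \<Phi>\<^sub>L x + \<Phi>\<^sub>R x ** \<Phi>\<^sub>R x) $ i $ i) \<longlongrightarrow> (c *\<^sub>R mat 1 :: mat3) $ i $ i) at_top"
      using c by (intro tendsto_vec_nth) (simp add: dagger_real_diagonal assms(6,7))
    then have "((\<lambda>x::real. 0::complex) \<longlongrightarrow> of_real c) at_top"
      unfolding entry by (simp add: vanish mat_def scaleR_matrix_entry del: vector_scaleR_component)
    then show False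
      using \<open>c > 0\<close> by (simp add: tendsto_const_iff)
  qed
  \<comment> \<open>Closedness is essential for the union: two sets with empty interior can together
    cover the line, but closed ones cannot.\<close>
  have Z_closed: "closed (Z i)" for i
    unfolding Z_def using assms(1,2)[THEN smooth_continuous_on]
    by (intro closed_Collect_conj closed_Collect_eq continuous_intros)
  have "interior (Z 1 \<union> Z 2 \<union> Z 3) = {}"
    using Z_interior Z_closed by (simp add: interior_closed_Un_empty_interior closed_Un)
  then have dense: "closure (- (Z 1 \<union> Z 2 \<union> Z 3)) = UNIV"
    unfolding closure_complement by simp
  have zero: "A x = 0" if "x \<in> - (Z 1 \<union> Z 2 \<union> Z 3)" for x
  proof (rule anticommutator_traceless_part_zero)
    \<comment> \<open>A sum of two real squares, positive exactly when \<open>x\<close> lies outside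
      \<open>Z i\<close>.\<close>
    let ?\<mu> = "\<lambda>i. (Re (\<Phi>\<^sub>L x $ i $ i))\<^sup>2 + (Re (\<Phi>\<^sub>R x $ i $ i))\<^sup>2"
    have real: "\<Phi>\<^sub>L x $ i $ i = of_real (Re (\<Phi>\<^sub>L x $ i $ i))"
      "\<Phi>\<^sub>R x $ i $ i = of_real (Re (\<Phi>\<^sub>R x $ i $ i))" for i
      using assms(6,7)[of x] by (simp_all add: real_diagonal_def of_real_Re)
    show "trace (A x) = 0"
      using assms(4) by (simp add: su3_def)
    show "traceless_part (anticommutator (A x) (\<Phi>\<^sub>L x ** \<Phi>\<^sub>L x + \<Phi>\<^sub>R x ** \<Phi>\<^sub>R x)) = 0"
      using gauge gauge_eom_real_diagonal[OF assms(1,2,6,7)] by simp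
    show "(\<Phi>\<^sub>L x ** \<Phi>\<^sub>L x + \<Phi>\<^sub>R x ** \<Phi>\<^sub>R x) $ i $ i = of_real (?\<mu> i)" for i
      unfolding entry using real[of i] by (simp add: power2_eq_square)
    show "(\<Phi>\<^sub>L x ** \<Phi>\<^sub>L x + \<Phi>\<^sub>R x ** \<Phi>\<^sub>R x) $ i $ j = 0" if "i \<noteq> j" for i j
      unfolding entry using that by (simp add: real_diagonal_offdiag assms(6,7))
    show "?\<mu> i > 0" for i
    proof -
      have "x \<notin> Z i"
        using that exhaust_3[of i] by auto
      then show ?thesis
        unfolding Z_def sum_power2_gt_zero_iff using real[of i] by auto
    qed
  qed
  have cont: "continuous_on (closure (- (Z 1 \<union> Z 2 \<union> Z 3))) A"
    using smooth_continuous_on[OF assms(3)] by (simp only: dense)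
  have "A x = 0" if "x \<in> closure (- (Z 1 \<union> Z 2 \<union> Z 3))" for x
    by (rule continuous_constant_on_closure[OF cont zero that])
  then show ?thesis
    unfolding dense by blast
qed

end
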